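(* Let $\widetilde{\mathrm N}_{3,2}=\mathrm N_{3,2}/\langle\langle x_1^2,x_2^2,x_3^2\rangle\rangle$, where $\mathrm N_{3,2}$ is the free $2$-step nilpotent group with basis $x_1,x_2,x_3$; let $Y=\{y_1,y_2,y_3\}$ be the image of $\{x_1,x_2,x_3\}$ in $\widetilde{\mathrm N}_{3,2}$, and let $z_{ij}=[y_i,y_j]$. Then the only element of $\widetilde{\mathrm N}_{3,2}$ that cannot be expressed as a product of three palindromes (with respect to $Y$) is $z_{21}z_{31}z_{32}$. Moreover, $l_{\mathcal P}(z_{21}z_{31}z_{32})=4$.
   Context: Let $G$ be a group with generating set $S$. A (freely) reduced word in the alphabet $S^{\pm1}$ is a palindrome if it reads the same left-to-right and right-to-left; an element of $G$ is a palindrome (with respect to $S$) if it is represented by some palindromic word in $S^{\pm1}$. The palindromic length $l_{\mathcal P}(g)$ of $g\in G$ is the minimal $k$ such that $g$ is a product of $k$ palindromes. The free $2$-step nilpotent group of rank $3$ is $\mathrm N_{3,2}=F_3/\gamma_3(F_3)$, with $F_3$ the free group of rank $3$ and $\gamma_3(F_3)=[[F_3,F_3],F_3]$. $\langle\langle\cdot\rangle\rangle$ denotes normal closure, and $[a,b]=a^{-1}b^{-1}ab$. *)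

theory Defs
  imports "HOL-Algebra.Generated_Groups" "HOL-Library.Extended_Nat"
begin

text \<open>
  A letter \<open>(s, True)\<close> stands for \<open>s\<close> and \<open>(s, False)\<close> for the formal inverse of \<open>s\<close>;
  a word in the alphabet \<open>S\<^sup>\<plusminus>\<^sup>1\<close> is a list over \<open>S \<times> UNIV\<close>.
\<close>

type_synonym 'a word = "('a \<times> bool) list"

fun inv_letter :: "'a \<times> bool \<Rightarrow> 'a \<times> bool" where
  "inv_letter (s, e) = (s, \<not> e)"

definition freely_reduced :: "'a word \<Rightarrow> bool" where
  "freely_reduced w \<longleftrightarrow> successively (\<lambda>a b. b \<noteq> inv_letter a) w"

fun cancel_cons :: "'a \<times> bool \<Rightarrow> 'a word \<Rightarrow> 'a word" where
  "cancel_cons a [] = [a]"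
| "cancel_cons a (b # w) = (if b = inv_letter a then w else a # b # w)"

definition free_reduction :: "'a word \<Rightarrow> 'a word" where
  "free_reduction w = foldr cancel_cons w []"

definition free_group :: "'a set \<Rightarrow> 'a word monoid" where
  "free_group X =
     \<lparr>carrier = {w. set w \<subseteq> X \<times> UNIV \<and> freely_reduced w},
      monoid.mult = (\<lambda>u v. free_reduction (u @ v)),
      one = []\<rparr>"

lemma inv_letter_inv_letter [simp]: "inv_letter (inv_letter a) = a"
  by (cases a) auto

lemma freely_reduced_Nil [simp]: "freely_reduced []"
  by (simp add: freely_reduced_def)

lemma freely_reduced_Cons:
  "freely_reduced (a # w) \<longleftrightarrow> (w = [] \<or> hd w \<noteq> inv_letter a) \<and> freely_reduced w"
  by (cases w) (auto simp: freely_reduced_def)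

lemma freely_reduced_cancel_cons:
  "freely_reduced w \<Longrightarrow> freely_reduced (cancel_cons a w)"
  by (cases w) (auto simp: freely_reduced_Cons)

lemma cancel_cons_reduced: "freely_reduced (a # w) \<Longrightarrow> cancel_cons a w = a # w"
  by (cases w) (auto simp: freely_reduced_Cons)

lemma cancel_cons_inv:
  assumes "freely_reduced w"
  shows "cancel_cons a (cancel_cons (inv_letter a) w) = w"
  using assms by (cases w) (auto simp: freely_reduced_Cons cancel_cons_reduced)

lemma free_reduction_Nil [simp]: "free_reduction [] = []"
  by (simp add: free_reduction_def)

lemma free_reduction_Cons: "free_reduction (a # w) = cancel_cons a (free_reduction w)"
  by (simp add: free_reduction_def)

lemma freely_reduced_free_reduction: "freely_reduced (free_reduction w)"
  by (induction w) (auto simp: free_reduction_Cons freely_reduced_cancel_cons)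

lemma free_reduction_reduced: "freely_reduced w \<Longrightarrow> free_reduction w = w"
  by (induction w)
    (auto simp: free_reduction_Cons freely_reduced_Cons intro!: cancel_cons_reduced)

lemma free_reduction_append:
  "free_reduction (u @ v) = foldr cancel_cons u (free_reduction v)"
  by (simp add: free_reduction_def)

lemma foldr_cancel_cons_reduced:
  "freely_reduced v \<Longrightarrow> freely_reduced (foldr cancel_cons u v)"
  by (induction u) (auto simp: freely_reduced_cancel_cons)

lemma foldr_cancel_cons_cancel_cons:
  assumes "freely_reduced v"
  shows "foldr cancel_cons (cancel_cons a u) v = cancel_cons a (foldr cancel_cons u v)"
proof (cases u)
  case (Cons b u')
  then show ?thesis
    using cancel_cons_inv[OF foldr_cancel_cons_reduced[OF assms], of a u'] by auto
qed simp

lemma free_reduction_append_left: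
  "free_reduction (free_reduction u @ v) = free_reduction (u @ v)"
  by (induction u)
    (simp_all add: free_reduction_append free_reduction_Cons foldr_cancel_cons_cancel_cons
      freely_reduced_free_reduction)

lemma free_reduction_append_right:
  "free_reduction (u @ free_reduction v) = free_reduction (u @ v)"
  by (simp add: free_reduction_append free_reduction_reduced freely_reduced_free_reduction)

lemma set_cancel_cons: "set (cancel_cons a w) \<subseteq> insert a (set w)"
  by (cases w) auto

lemma set_free_reduction: "set (free_reduction w) \<subseteq> set w"
proof (induction w)
  case (Cons a w)
  then show ?case using set_cancel_cons[of a "free_reduction w"]
    by (auto simp: free_reduction_Cons)
qed simp

lemma free_reduction_inverse: "free_reduction (map inv_letter (rev w) @ w) = []"
proof (induction w)
  case (Cons a w)
  have "free_reduction (map inv_letter (rev (a # w)) @ a # w) =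
        foldr cancel_cons (map inv_letter (rev w))
          (cancel_cons (inv_letter a) (cancel_cons (inv_letter (inv_letter a)) (free_reduction w)))"
    by (simp add: free_reduction_append free_reduction_Cons)
  also have "\<dots> = free_reduction (map inv_letter (rev w) @ w)"
    by (simp only: cancel_cons_inv freely_reduced_free_reduction free_reduction_append)
  finally show ?case using Cons.IH by simp
qed simp

lemma group_free_group: "group (free_group X)"
proof (rule groupI)
  fix u assume u: "u \<in> carrier (free_group X)"
  let ?v = "free_reduction (map inv_letter (rev u))"
  have "set (map inv_letter (rev u)) \<subseteq> X \<times> UNIV"
    using u by (auto simp: free_group_def)
  then have "?v \<in> carrier (free_group X)"
    using set_free_reduction[of "map inv_letter (rev u)"]
    by (auto simp: free_group_def freely_reduced_free_reduction)
  moreover have "?v \<otimes>\<^bsub>free_group X\<^esub> u = \<one>\<^bsub>free_group X\<^esub>"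
    by (simp add: free_group_def free_reduction_append_left free_reduction_inverse)
  ultimately show "\<exists>v\<in>carrier (free_group X). v \<otimes>\<^bsub>free_group X\<^esub> u = \<one>\<^bsub>free_group X\<^esub>" by blast
next
  fix u v assume "u \<in> carrier (free_group X)" "v \<in> carrier (free_group X)"
  then show "u \<otimes>\<^bsub>free_group X\<^esub> v \<in> carrier (free_group X)"
    using set_free_reduction[of "u @ v"]
    by (auto simp: free_group_def freely_reduced_free_reduction)
qed (auto simp: free_group_def free_reduction_append_left free_reduction_append_right
       free_reduction_reduced)

definition commutator :: "('a, 'b) monoid_scheme \<Rightarrow> 'a \<Rightarrow> 'a \<Rightarrow> 'a" where
  "commutator G a b = inv\<^bsub>G\<^esub> a \<otimes>\<^bsub>G\<^esub> inv\<^bsub>G\<^esub> b \<otimes>\<^bsub>G\<^esub> a \<otimes>\<^bsub>G\<^esub> b"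

definition commutator_subgroup :: "('a, 'b) monoid_scheme \<Rightarrow> 'a set \<Rightarrow> 'a set \<Rightarrow> 'a set" where
  "commutator_subgroup G H K = generate G {commutator G h k | h k. h \<in> H \<and> k \<in> K}"

definition normal_closure :: "('a, 'b) monoid_scheme \<Rightarrow> 'a set \<Rightarrow> 'a set" where
  "normal_closure G R = \<Inter> {N. N \<lhd> G \<and> R \<subseteq> N}"

definition word_value :: "('a, 'b) monoid_scheme \<Rightarrow> 'a word \<Rightarrow> 'a" where
  "word_value G w = foldr (\<lambda>(s, e) g. (if e then s else inv\<^bsub>G\<^esub> s) \<otimes>\<^bsub>G\<^esub> g) w \<one>\<^bsub>G\<^esub>"

definition is_palindrome :: "('a, 'b) monoid_scheme \<Rightarrow> 'a set \<Rightarrow> 'a \<Rightarrow> bool" where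
  "is_palindrome G S g \<longleftrightarrow>
     (\<exists>w. set w \<subseteq> S \<times> UNIV \<and> freely_reduced w \<and> rev w = w \<and> word_value G w = g)"

definition product_of_palindromes ::
    "('a, 'b) monoid_scheme \<Rightarrow> 'a set \<Rightarrow> nat \<Rightarrow> 'a \<Rightarrow> bool" where
  "product_of_palindromes G S k g \<longleftrightarrow>
     (\<exists>ps. length ps = k \<and> (\<forall>p\<in>set ps. is_palindrome G S p) \<and>
           foldr (\<otimes>\<^bsub>G\<^esub>) ps \<one>\<^bsub>G\<^esub> = g)"

text \<open>
  The infimum is the minimum whenever some \<open>k\<close> exists; it is \<open>\<infinity>\<close> otherwise, so a finite value
  always asserts that \<open>g\<close> is a product of palindromes.
\<close>

definition palindromic_length :: "('a, 'b) monoid_scheme \<Rightarrow> 'a set \<Rightarrow> 'a \<Rightarrow> enat" where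
  "palindromic_length G S g = Inf {enat k | k. product_of_palindromes G S k g}"

definition F3 :: "nat word monoid" where
  "F3 = free_group {1, 2, 3}"

definition gamma3_F3 :: "nat word set" where
  "gamma3_F3 = commutator_subgroup F3 (commutator_subgroup F3 (carrier F3) (carrier F3)) (carrier F3)"

definition N32 :: "nat word set monoid" where
  "N32 = F3 Mod gamma3_F3"

definition x_gen :: "nat \<Rightarrow> nat word set" where
  "x_gen i = gamma3_F3 #>\<^bsub>F3\<^esub> [(i, True)]"

definition squares_closure :: "nat word set set" where
  "squares_closure = normal_closure N32 {x_gen i [^]\<^bsub>N32\<^esub> (2::nat) | i. i \<in> {1, 2, 3}}"

definition N32_tilde :: "nat word set set monoid" where
  "N32_tilde = N32 Mod squares_closure"

definition y_gen :: "nat \<Rightarrow> nat word set set" where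
  "y_gen i = squares_closure #>\<^bsub>N32\<^esub> x_gen i"

definition Y_gens :: "nat word set set set" where
  "Y_gens = {y_gen 1, y_gen 2, y_gen 3}"

definition z_comm :: "nat \<Rightarrow> nat \<Rightarrow> nat word set set" where
  "z_comm i j = commutator N32_tilde (y_gen i) (y_gen j)"

end

theory Submission
  imports Defs "HOL-Library.Z2"
begin

text \<open>
  In \<open>N32_tilde\<close> the generators \<open>y\<^sub>i\<close> are involutions and the commutators \<open>z\<^sub>i\<^sub>j\<close> are central
  of order two, so every element is a product of powers of
  \<open>y\<^sub>1, y\<^sub>2, y\<^sub>3, z\<^sub>2\<^sub>1, z\<^sub>3\<^sub>1, z\<^sub>3\<^sub>2\<close>, in this order,
  with exponents modulo 2. That these 64 normal forms are pairwise distinct is shown by mapping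
  the group to an explicit group of sextuples of bits: \<open>iso_coords_group\<close> says that a group of
  nilpotency class two generated by three involutions is this coordinate group as soon as it maps
  to it generator by generator, and \<open>N32_tilde_to_coords\<close> supplies the map from the universal
  properties of free groups and of quotients.

  An isomorphism respects palindromes (\<open>product_of_palindromes_iso\<close>), so the rest takes place in
  coordinates. Since the generators are involutions, reversing a word inverts its value; hence a
  palindrome of even length has value 1 and one of odd length is a conjugate of its middle letter.
  The conjugates of \<open>y\<^sub>i\<close> are its products with the elements of the subgroup generated by the
  two commutators that involve \<open>y\<^sub>i\<close> (\<open>is_palindrome_iff\<close>).

  If a product of three such elements lies in the commutator subgroup, its factors are 1 or
  conjugates of generators that cancel modulo commutators: it is 1 or a product of two conjugates
  of the same \<open>y\<^sub>i\<close>. So it lies in one of the three planes of \<open>(\<int>/2)\<^sup>3\<close> spanned by two of the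
  \<open>z\<^sub>i\<^sub>j\<close>, and these planes cover everything but \<open>z\<^sub>2\<^sub>1 z\<^sub>3\<^sub>1 z\<^sub>3\<^sub>2\<close>. Outside the commutator
  subgroup, conjugates of two different generators can be used, which makes all three commutators
  available (\<open>not_product_of_three_palindromes_iff\<close>). In particular
  \<open>y\<^sub>1 z\<^sub>2\<^sub>1 z\<^sub>3\<^sub>1 z\<^sub>3\<^sub>2\<close> is a product of three palindromes, and a further factor \<open>y\<^sub>1\<close> gives
  length four for the exception.
\<close>

section \<open>Words and free groups\<close>

lemma word_value_Nil [simp]: "word_value G [] = \<one>\<^bsub>G\<^esub>"
  by (simp add: word_value_def)

lemma word_value_Cons [simp]:
  "word_value G ((s, b) # w) = (if b then s else inv\<^bsub>G\<^esub> s) \<otimes>\<^bsub>G\<^esub> word_value G w"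
  by (simp add: word_value_def)

lemma (in group) word_value_closed:
  "set w \<subseteq> carrier G \<times> UNIV \<Longrightarrow> word_value G w \<in> carrier G"
  by (induction w) auto

lemma (in group) word_value_append:
  assumes "set u \<subseteq> carrier G \<times> UNIV" "set v \<subseteq> carrier G \<times> UNIV"
  shows "word_value G (u @ v) = word_value G u \<otimes> word_value G v"
  using assms by (induction u) (auto simp: word_value_closed m_assoc)

lemma map_apfst_letters:
  assumes "set w \<subseteq> X \<times> UNIV" and "f ` X \<subseteq> Y"
  shows "set (map (apfst f) w) \<subseteq> Y \<times> UNIV"
  using assms by fastforce

lemma (in group_hom) hom_word_value:
  "set w \<subseteq> carrier G \<times> UNIV \<Longrightarrow> h (word_value G w) = word_value H (map (apfst h) w)"
  by (induction w) (auto simp: G.word_value_closed)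

text \<open>
  Inserting a letter and cancelling does not change the value, whatever group elements the
  letters stand for; so the value of a word depends only on its free reduction.
\<close>

lemma (in group) word_value_cancel_cons:
  assumes "f ` X \<subseteq> carrier G" and "a \<in> X \<times> UNIV" and "set w \<subseteq> X \<times> UNIV"
  shows "word_value G (map (apfst f) (cancel_cons a w)) = word_value G (map (apfst f) (a # w))"
proof (cases w)
  case (Cons b v)
  obtain s e where a: "a = (s, e)" by fastforce
  have "f s \<in> carrier G" using assms a by auto
  moreover have "word_value G (map (apfst f) v) \<in> carrier G"
    using map_apfst_letters[OF _ assms(1), of v] assms(3) Cons by (intro word_value_closed) auto
  ultimately show ?thesis using Cons a by (auto simp flip: m_assoc)
qed simp

lemma (in group) word_value_free_reduction:
  assumes "f ` X \<subseteq> carrier G" and "set w \<subseteq> X \<times> UNIV"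
  shows "word_value G (map (apfst f) (free_reduction w)) = word_value G (map (apfst f) w)"
  using assms(2)
proof (induction w)
  case (Cons a w)
  have "set (free_reduction w) \<subseteq> X \<times> UNIV"
    using set_free_reduction[of w] Cons.prems by auto
  then have "word_value G (map (apfst f) (free_reduction (a # w))) =
        word_value G (map (apfst f) (a # free_reduction w))"
    unfolding free_reduction_Cons using Cons.prems by (intro word_value_cancel_cons[OF assms(1)]) auto
  also have "\<dots> = word_value G (map (apfst f) (a # w))"
    using Cons by (cases a) auto
  finally show ?case .
qed simp

text \<open>The universal property of the free group.\<close>

lemma (in group) free_group_lift:
  assumes "f ` X \<subseteq> carrier G"
  shows "(\<lambda>w. word_value G (map (apfst f) w)) \<in> hom (free_group X) G"
proof (rule homI)
  fix u assume "u \<in> carrier (free_group X)"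
  then show "word_value G (map (apfst f) u) \<in> carrier G"
    using map_apfst_letters[OF _ assms, of u] by (intro word_value_closed) (simp add: free_group_def)
next
  fix u v assume "u \<in> carrier (free_group X)" "v \<in> carrier (free_group X)"
  then have uv: "set u \<subseteq> X \<times> UNIV" "set v \<subseteq> X \<times> UNIV" by (auto simp: free_group_def)
  then have "set (u @ v) \<subseteq> X \<times> UNIV" by simp
  then show "word_value G (map (apfst f) (u \<otimes>\<^bsub>free_group X\<^esub> v)) =
        word_value G (map (apfst f) u) \<otimes> word_value G (map (apfst f) v)"
    using word_value_append[OF uv[THEN map_apfst_letters[OF _ assms]]]
    by (simp add: free_group_def word_value_free_reduction[OF assms])
qed

lemma free_group_letter_closed: "s \<in> X \<Longrightarrow> [(s, b)] \<in> carrier (free_group X)"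
  by (simp add: free_group_def freely_reduced_def)

lemma free_group_inv_letter:
  assumes "s \<in> X"
  shows "inv\<^bsub>free_group X\<^esub> [(s, True)] = [(s, False)]"
  by (rule group.inv_equality[OF group_free_group])
    (use assms in \<open>auto simp: free_group_letter_closed\<close>,
     simp add: free_group_def free_reduction_def)

text \<open>
  Every element of the free group is the value of itself as a word. Hence the image of \<open>w\<close> under
  a homomorphism is the value of \<open>w\<close> on the images of the generators.
\<close>

lemma free_group_word_value:
  assumes "w \<in> carrier (free_group X)"
  shows "word_value (free_group X) (map (apfst (\<lambda>s. [(s, True)])) w) = w"
proof -
  have "set w \<subseteq> X \<times> UNIV" "freely_reduced w" using assms by (auto simp: free_group_def)
  then show ?thesis
  proof (induction w)
    case Nil
    show ?case by (simp add: free_group_def)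
  next
    case (Cons a w)
    obtain s b where a: "a = (s, b)" by fastforce
    have s: "s \<in> X" using Cons.prems a by auto
    have "word_value (free_group X) (map (apfst (\<lambda>s. [(s, True)])) (a # w)) =
        [a] \<otimes>\<^bsub>free_group X\<^esub> w"
      using Cons a s by (auto simp: freely_reduced_Cons free_group_inv_letter)
    also have "\<dots> = a # w" using Cons.prems by (simp add: free_group_def free_reduction_reduced)
    finally show ?case .
  qed
qed

section \<open>Commutators, class two and normal closures\<close>

lemma (in group) mult_inv_cancel:
  assumes "x \<in> carrier G" "g \<in> carrier G"
  shows "x \<otimes> (inv x \<otimes> g) = g" and "inv x \<otimes> (x \<otimes> g) = g"
  using assms by (simp_all flip: m_assoc)

lemma (in group) commutator_closed [simp]:
  "\<lbrakk>x \<in> carrier G; y \<in> carrier G\<rbrakk> \<Longrightarrow> commutator G x y \<in> carrier G"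
  by (simp add: commutator_def)

lemma (in group_hom) hom_commutator:
  "\<lbrakk>x \<in> carrier G; y \<in> carrier G\<rbrakk> \<Longrightarrow> h (commutator G x y) = commutator H (h x) (h y)"
  by (simp add: commutator_def)

lemma (in group) mult_eq_mult_commutator:
  "\<lbrakk>x \<in> carrier G; y \<in> carrier G\<rbrakk> \<Longrightarrow> x \<otimes> y = y \<otimes> x \<otimes> commutator G x y"
  by (simp add: commutator_def m_assoc mult_inv_cancel)

lemma (in group) commutator_eq_one_iff:
  "\<lbrakk>x \<in> carrier G; y \<in> carrier G\<rbrakk> \<Longrightarrow> commutator G x y = \<one> \<longleftrightarrow> x \<otimes> y = y \<otimes> x"
  using mult_eq_mult_commutator[of x y] Units_l_cancel[of "y \<otimes> x" "commutator G x y" \<one>] by simp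

text \<open>
  Conjugation is a homomorphism, so it maps commutators to commutators; this is why commutator
  subgroups of normal subgroups are normal.
\<close>

lemma (in group) conj_hom:
  assumes "g \<in> carrier G"
  shows "group_hom G G (\<lambda>x. g \<otimes> x \<otimes> inv g)"
proof -
  have "(\<lambda>x. g \<otimes> x \<otimes> inv g) \<in> hom G G"
    using assms by (intro homI) (simp_all add: m_assoc mult_inv_cancel)
  then show ?thesis by (simp add: group_hom_def group_hom_axioms_def)
qed

lemma (in group) normal_commutator_subgroup:
  assumes "H \<lhd> G" "K \<lhd> G"
  shows "commutator_subgroup G H K \<lhd> G"
  unfolding commutator_subgroup_def
proof (rule normal_generateI)
  have sub: "H \<subseteq> carrier G" "K \<subseteq> carrier G"
    using assms by (auto dest!: normal_imp_subgroup subgroup.subset)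
  then show "{commutator G h k |h k. h \<in> H \<and> k \<in> K} \<subseteq> carrier G"
    by (auto intro!: commutator_closed)
  fix c g assume "c \<in> {commutator G h k |h k. h \<in> H \<and> k \<in> K}" and g: "g \<in> carrier G"
  then obtain h k where hk: "h \<in> H" "k \<in> K" "c = commutator G h k" by auto
  have "g \<otimes> c \<otimes> inv g = commutator G (g \<otimes> h \<otimes> inv g) (g \<otimes> k \<otimes> inv g)"
    using group_hom.hom_commutator[OF conj_hom[OF g]] hk sub by blast
  moreover have "g \<otimes> h \<otimes> inv g \<in> H" "g \<otimes> k \<otimes> inv g \<in> K"
    using assms hk g by (auto simp: normal_inv_iff)
  ultimately show "g \<otimes> c \<otimes> inv g \<in> {commutator G h k |h k. h \<in> H \<and> k \<in> K}" by blast
qed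

lemma (in group) normal_carrier: "carrier G \<lhd> G"
  by (simp add: normal_inv_iff subgroup_self)

lemma (in group) normal_normal_closure:
  assumes "R \<subseteq> carrier G"
  shows "normal_closure G R \<lhd> G"
proof -
  have "subgroup (normal_closure G R) G" unfolding normal_closure_def
    using normal_carrier assms by (intro subgroups_Inter) (auto intro: normal_imp_subgroup)
  moreover have "x \<otimes> h \<otimes> inv x \<in> normal_closure G R"
    if "x \<in> carrier G" "h \<in> normal_closure G R" for x h
    using that unfolding normal_closure_def by (blast dest: normal.inv_op_closed2)
  ultimately show ?thesis by (simp add: normal_inv_iff)
qed

lemma subset_normal_closure: "R \<subseteq> normal_closure G R"
  by (auto simp: normal_closure_def)

lemma normal_closure_least: "\<lbrakk>N \<lhd> G; R \<subseteq> N\<rbrakk> \<Longrightarrow> normal_closure G R \<subseteq> N"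
  by (auto simp: normal_closure_def)

definition gamma3 :: "('a, 'b) monoid_scheme \<Rightarrow> 'a set" where
  "gamma3 G = commutator_subgroup G (commutator_subgroup G (carrier G) (carrier G)) (carrier G)"

definition class_two :: "('a, 'b) monoid_scheme \<Rightarrow> bool" where
  "class_two G \<longleftrightarrow> (\<forall>x\<in>carrier G. \<forall>y\<in>carrier G. \<forall>g\<in>carrier G.
     commutator G x y \<otimes>\<^bsub>G\<^esub> g = g \<otimes>\<^bsub>G\<^esub> commutator G x y)"

lemma (in group) normal_gamma3: "gamma3 G \<lhd> G"
  by (simp add: gamma3_def normal_commutator_subgroup normal_carrier)

text \<open>
  The elements with central image form a subgroup. It contains the commutators, hence the whole
  second term of the lower central series, and so commutators with that term die.
\<close>

lemma (in group_hom) gamma3_subset_kernel: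
  assumes "class_two H"
  shows "gamma3 G \<subseteq> kernel G H h"
proof -
  let ?C = "{g \<in> carrier G. \<forall>x\<in>carrier H. h g \<otimes>\<^bsub>H\<^esub> x = x \<otimes>\<^bsub>H\<^esub> h g}"
  have "subgroup ?C G"
  proof (rule G.subgroupI)
    fix a assume "a \<in> ?C"
    then have a: "a \<in> carrier G" "\<And>x. x \<in> carrier H \<Longrightarrow> h a \<otimes>\<^bsub>H\<^esub> x = x \<otimes>\<^bsub>H\<^esub> h a"
      by auto
    have "inv\<^bsub>H\<^esub> (h a) \<otimes>\<^bsub>H\<^esub> x = x \<otimes>\<^bsub>H\<^esub> inv\<^bsub>H\<^esub> (h a)" if x: "x \<in> carrier H" for x
    proof -
      have "x = h a \<otimes>\<^bsub>H\<^esub> (x \<otimes>\<^bsub>H\<^esub> inv\<^bsub>H\<^esub> (h a))"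
        using a x by (simp add: H.m_assoc)
      then show ?thesis using a(1) x H.inv_solve_left' by simp
    qed
    with a(1) show "inv a \<in> ?C" by simp
  next
    fix a b assume "a \<in> ?C" "b \<in> ?C"
    then have ab: "a \<in> carrier G" "b \<in> carrier G"
        "\<And>x. x \<in> carrier H \<Longrightarrow> h a \<otimes>\<^bsub>H\<^esub> x = x \<otimes>\<^bsub>H\<^esub> h a"
        "\<And>x. x \<in> carrier H \<Longrightarrow> h b \<otimes>\<^bsub>H\<^esub> x = x \<otimes>\<^bsub>H\<^esub> h b"
      by auto
    have "h (a \<otimes> b) \<otimes>\<^bsub>H\<^esub> x = x \<otimes>\<^bsub>H\<^esub> h (a \<otimes> b)" if x: "x \<in> carrier H" for x
    proof -
      have "h (a \<otimes> b) \<otimes>\<^bsub>H\<^esub> x = h a \<otimes>\<^bsub>H\<^esub> (x \<otimes>\<^bsub>H\<^esub> h b)"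
        using ab(1,2) ab(4)[OF x] x by (simp add: H.m_assoc)
      also have "\<dots> = x \<otimes>\<^bsub>H\<^esub> h (a \<otimes> b)"
        using ab(1,2) ab(3)[OF x] x by (simp flip: H.m_assoc)
      finally show ?thesis .
    qed
    with ab(1,2) show "a \<otimes> b \<in> ?C" by simp
  next
    have "\<one> \<in> ?C" by simp
    then show "?C \<noteq> {}" by blast
  qed simp_all
  moreover have "{commutator G x y |x y. x \<in> carrier G \<and> y \<in> carrier G} \<subseteq> ?C"
    using assms unfolding class_two_def by (auto simp: hom_commutator)
  ultimately have "commutator_subgroup G (carrier G) (carrier G) \<subseteq> ?C"
    unfolding commutator_subgroup_def by (intro G.generate_subgroup_incl)
  then have "commutator G g x \<in> kernel G H h"
    if "g \<in> commutator_subgroup G (carrier G) (carrier G)" "x \<in> carrier G" for g x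
    using that by (auto simp: kernel_def hom_commutator H.commutator_eq_one_iff)
  then have "{commutator G g x |g x. g \<in> commutator_subgroup G (carrier G) (carrier G) \<and>
      x \<in> carrier G} \<subseteq> kernel G H h"
    by blast
  from G.generate_subgroup_incl[OF this subgroup_kernel] show ?thesis
    by (simp add: gamma3_def commutator_subgroup_def[of G "commutator_subgroup G A B" for A B])
qed

text \<open>The converse for surjections: triple commutators lift to \<open>gamma3 G\<close>.\<close>

lemma (in group_hom) class_two_of_surj:
  assumes "h ` carrier G = carrier H" and "gamma3 G \<subseteq> kernel G H h"
  shows "class_two H"
  unfolding class_two_def
proof (intro ballI)
  fix x y g assume "x \<in> carrier H" "y \<in> carrier H" "g \<in> carrier H"
  then have "x \<in> h ` carrier G" "y \<in> h ` carrier G" "g \<in> h ` carrier G"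
    by (simp_all add: assms(1))
  then obtain u v w where uvw: "u \<in> carrier G" "v \<in> carrier G" "w \<in> carrier G"
    and eq: "x = h u" "y = h v" "g = h w"
    by blast
  have "commutator G u v \<in> commutator_subgroup G (carrier G) (carrier G)"
    unfolding commutator_subgroup_def using uvw by (intro generate.incl) auto
  then have "commutator G (commutator G u v) w \<in> gamma3 G"
    unfolding gamma3_def commutator_subgroup_def[of G "commutator_subgroup G A B" for A B]
    using uvw by (intro generate.incl) auto
  then have "commutator H (commutator H x y) g = \<one>\<^bsub>H\<^esub>"
    using assms(2) uvw eq by (auto simp: kernel_def hom_commutator)
  then show "commutator H x y \<otimes>\<^bsub>H\<^esub> g = g \<otimes>\<^bsub>H\<^esub> commutator H x y"
    using uvw eq by (simp add: H.commutator_eq_one_iff)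
qed

section \<open>A coordinate model of order 64\<close>

type_synonym coords = "bit \<times> bit \<times> bit \<times> bit \<times> bit \<times> bit"

text \<open>
  The sextuple \<open>(a\<^sub>1, a\<^sub>2, a\<^sub>3, c\<^sub>2\<^sub>1, c\<^sub>3\<^sub>1, c\<^sub>3\<^sub>2)\<close> lists the exponents of the normal form. To
  collect a product, each \<open>y\<^sub>j\<close> of the left factor has to pass each \<open>y\<^sub>i\<close> with \<open>i < j\<close> of the right
  factor, which costs one \<open>z\<^sub>j\<^sub>i\<close>; this is the term \<open>a\<^sub>j b\<^sub>i\<close>.
\<close>

fun coords_mult :: "coords \<Rightarrow> coords \<Rightarrow> coords" where
  "coords_mult (a1, a2, a3, c21, c31, c32) (b1, b2, b3, d21, d31, d32) =
     (a1 + b1, a2 + b2, a3 + b3, c21 + d21 + a2 * b1, c31 + d31 + a3 * b1, c32 + d32 + a3 * b2)"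

definition coords_group :: "coords monoid" where
  "coords_group = \<lparr>carrier = UNIV, monoid.mult = coords_mult, one = (0, 0, 0, 0, 0, 0)\<rparr>"

definition e_gen :: "nat \<Rightarrow> coords" where
  "e_gen i = (of_bool (i = 1), of_bool (i = 2), of_bool (i = 3), 0, 0, 0)"

text \<open>
  Addition and multiplication of bits must stay ring operations: rewritten to Boolean connectives,
  the polynomial identities below are out of reach of ring normalisation.
\<close>

declare add_bit_eq_xor [simp del] mult_bit_eq_and [simp del]

lemma bit_add_self [simp]: "(x::bit) + x = 0"
  by (cases x) (simp_all add: add_bit_eq_xor)

lemma bit_add_self_left [simp]: "x + (x + y) = (y::bit)"
  by (simp flip: add.assoc)

lemma coords_group_simps [simp]:
  "carrier coords_group = UNIV" "\<one>\<^bsub>coords_group\<^esub> = (0, 0, 0, 0, 0, 0)"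
  "x \<otimes>\<^bsub>coords_group\<^esub> y = coords_mult x y"
  by (simp_all add: coords_group_def)

lemma coords_inverse:
  "coords_mult (a1, a2, a3, c21 + a2 * a1, c31 + a3 * a1, c32 + a3 * a2)
     (a1, a2, a3, c21, c31, c32) = (0, 0, 0, 0, 0, 0)"
  by (simp add: ac_simps)

lemma group_coords_group: "group coords_group"
proof (rule groupI)
  fix x assume "x \<in> carrier coords_group"
  obtain a1 a2 a3 c21 c31 c32 where "x = (a1, a2, a3, c21, c31, c32)" by (cases x) auto
  then show "\<exists>y\<in>carrier coords_group. y \<otimes>\<^bsub>coords_group\<^esub> x = \<one>\<^bsub>coords_group\<^esub>"
    using coords_inverse[of a1 a2 a3 c21 c31 c32] by (metis UNIV_I coords_group_simps)
next
  fix x y z assume "x \<in> carrier coords_group" "y \<in> carrier coords_group" "z \<in> carrier coords_group"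
  show "x \<otimes>\<^bsub>coords_group\<^esub> y \<otimes>\<^bsub>coords_group\<^esub> z =
      x \<otimes>\<^bsub>coords_group\<^esub> (y \<otimes>\<^bsub>coords_group\<^esub> z)"
    by (cases x; cases y; cases z) (simp add: algebra_simps)
next
  fix x assume "x \<in> carrier coords_group"
  show "\<one>\<^bsub>coords_group\<^esub> \<otimes>\<^bsub>coords_group\<^esub> x = x"
    by (cases x) simp
qed simp_all

interpretation coords: group coords_group
  by (rule group_coords_group)

lemma coords_inv:
  "inv\<^bsub>coords_group\<^esub> (a1, a2, a3, c21, c31, c32) =
     (a1, a2, a3, c21 + a2 * a1, c31 + a3 * a1, c32 + a3 * a2)"
  by (rule coords.inv_equality) (use coords_inverse in auto)

lemma coords_commutator:
  "commutator coords_group (a1, a2, a3, c21, c31, c32) (b1, b2, b3, d21, d31, d32) =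
     (0, 0, 0, a2 * b1 + a1 * b2, a3 * b1 + a1 * b3, a3 * b2 + a2 * b3)"
  by (simp add: commutator_def coords_inv algebra_simps)

lemma coords_class_two: "class_two coords_group"
  by (auto simp: class_two_def coords_commutator ac_simps)

lemma inv_e_gen [simp]: "i \<in> {1, 2, 3} \<Longrightarrow> inv\<^bsub>coords_group\<^esub> (e_gen i) = e_gen i"
  by (auto simp: e_gen_def coords_inv)

section \<open>Presentation of the coordinate group\<close>

locale class_two_three_involutions = group +
  fixes y :: "nat \<Rightarrow> 'a"
  assumes class_two: "class_two G"
    and y_carrier: "i \<in> {1, 2, 3} \<Longrightarrow> y i \<in> carrier G"
    and y_square: "i \<in> {1, 2, 3} \<Longrightarrow> y i \<otimes> y i = \<one>"
begin

abbreviation "z i j \<equiv> commutator G (y i) (y j)"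

definition bpow :: "'a \<Rightarrow> bit \<Rightarrow> 'a" where
  "bpow x b = (if b = 1 then x else \<one>)"

fun normal_form :: "coords \<Rightarrow> 'a" where
  "normal_form (a1, a2, a3, c21, c31, c32) =
     bpow (y 1) a1 \<otimes> (bpow (y 2) a2 \<otimes> (bpow (y 3) a3 \<otimes>
       (bpow (z 2 1) c21 \<otimes> (bpow (z 3 1) c31 \<otimes> bpow (z 3 2) c32))))"

lemma y_closed [simp]: "y 1 \<in> carrier G" "y (Suc 0) \<in> carrier G" "y 2 \<in> carrier G" "y 3 \<in> carrier G"
  using y_carrier[of 1] y_carrier[of 2] y_carrier[of 3] by auto

lemma inv_y: "i \<in> {1, 2, 3} \<Longrightarrow> inv (y i) = y i"
  using y_carrier[of i] y_square[of i] by (intro inv_equality)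

lemma bpow_closed [simp]: "x \<in> carrier G \<Longrightarrow> bpow x b \<in> carrier G"
  by (simp add: bpow_def)

lemma bpow_absorb:
  assumes "x \<otimes> x = \<one>" "x \<in> carrier G" "r \<in> carrier G"
  shows "bpow x a \<otimes> (bpow x b \<otimes> r) = bpow x (a + b) \<otimes> r"
  using assms by (cases a; cases b) (simp_all add: bpow_def flip: m_assoc)

lemma z_central: "\<lbrakk>i \<in> {1, 2, 3}; j \<in> {1, 2, 3}; g \<in> carrier G\<rbrakk> \<Longrightarrow> z i j \<otimes> g = g \<otimes> z i j"
  using class_two y_carrier unfolding class_two_def by blast

text \<open>
  With involutions, \<open>z i j = y i y j y i y j\<close>. Moving a central factor \<open>z i j\<close> past the first letter
  of this word makes the square collapse letter by letter.
\<close>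

lemma z_square:
  assumes "i \<in> {1, 2, 3}" "j \<in> {1, 2, 3}"
  shows "z i j \<otimes> z i j = \<one>"
proof -
  have c [simp]: "y i \<in> carrier G" "y j \<in> carrier G" using assms y_carrier by blast+
  have cancel: "y k \<otimes> (y k \<otimes> g) = g" if "k \<in> {1, 2, 3}" "g \<in> carrier G" for k g
    using that y_square[of k] y_carrier[of k] by (simp flip: m_assoc)
  have z: "z i j = y i \<otimes> (y j \<otimes> (y i \<otimes> y j))"
    using assms by (simp add: commutator_def inv_y m_assoc)
  have zc: "z i j \<in> carrier G" by simp
  have "z i j \<otimes> z i j = z i j \<otimes> (y i \<otimes> (y j \<otimes> (y i \<otimes> y j)))"
    by (subst (2) z) simp
  also have "\<dots> = y i \<otimes> z i j \<otimes> (y j \<otimes> (y i \<otimes> y j))"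
    using z_central[of i j "y i"] assms zc by (simp flip: m_assoc)
  also have "\<dots> = \<one>"
    using assms by (simp add: z m_assoc cancel y_square)
  finally show ?thesis .
qed

lemma z_closed [simp]: "\<lbrakk>i \<in> {1, 2, 3}; j \<in> {1, 2, 3}\<rbrakk> \<Longrightarrow> z i j \<in> carrier G"
  using y_carrier by simp

lemma bpow_z_central:
  assumes "i \<in> {1, 2, 3}" "j \<in> {1, 2, 3}" "g \<in> carrier G" "r \<in> carrier G"
  shows "bpow (z i j) b \<otimes> (g \<otimes> r) = g \<otimes> (bpow (z i j) b \<otimes> r)"
proof -
  have "bpow (z i j) b \<otimes> g = g \<otimes> bpow (z i j) b"
    using assms z_central by (cases b) (simp_all add: bpow_def)
  then show ?thesis using assms m_assoc z_closed bpow_closed by metis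
qed

lemma y_past_y:
  assumes "i \<in> {1, 2, 3}" "j \<in> {1, 2, 3}" "r \<in> carrier G"
  shows "y j \<otimes> (bpow (y i) b \<otimes> r) = bpow (y i) b \<otimes> (y j \<otimes> (bpow (z j i) b \<otimes> r))"
proof -
  have c: "y i \<in> carrier G" "y j \<in> carrier G" "z j i \<in> carrier G"
    using assms y_carrier z_closed by blast+
  then show ?thesis using assms(3) mult_eq_mult_commutator[of "y j" "y i"]
    by (cases b) (simp_all add: bpow_def m_assoc[symmetric])
qed

lemma y_absorb:
  assumes "i \<in> {1, 2, 3}" "r \<in> carrier G"
  shows "y i \<otimes> (bpow (y i) b \<otimes> r) = bpow (y i) (1 + b) \<otimes> r"
  using bpow_absorb[OF y_square y_carrier, of i r 1 b] assms by (simp add: bpow_def)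

lemma z_absorb:
  assumes "i \<in> {1, 2, 3}" "j \<in> {1, 2, 3}"
  shows "r \<in> carrier G \<Longrightarrow> bpow (z i j) a \<otimes> (bpow (z i j) b \<otimes> r) = bpow (z i j) (a + b) \<otimes> r"
    and "bpow (z i j) a \<otimes> bpow (z i j) b = bpow (z i j) (a + b)"
proof -
  have *: "bpow (z i j) a \<otimes> (bpow (z i j) b \<otimes> r) = bpow (z i j) (a + b) \<otimes> r" if "r \<in> carrier G" for r
    using assms z_square z_closed that by (intro bpow_absorb)
  then show "r \<in> carrier G \<Longrightarrow> bpow (z i j) a \<otimes> (bpow (z i j) b \<otimes> r) = bpow (z i j) (a + b) \<otimes> r" .
  show "bpow (z i j) a \<otimes> bpow (z i j) b = bpow (z i j) (a + b)"
    using *[OF one_closed] assms z_closed[of i j] bpow_closed by simp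
qed

lemma normal_form_closed: "normal_form m \<in> carrier G"
  by (cases m) simp

text \<open>
  Collection: the new letter passes the generators of smaller index, leaving commutators behind, is absorbed
  by its own power, and the commutators then move to the right.
\<close>

lemma y_mult_normal_form:
  assumes "i \<in> {1, 2, 3}"
  shows "y i \<otimes> normal_form m = normal_form (coords_mult (e_gen i) m)"
proof -
  obtain b1 b2 b3 d21 d31 d32 where m: "m = (b1, b2, b3, d21, d31, d32)" by (cases m) auto
  have "y 1 \<otimes> normal_form m = normal_form (coords_mult (e_gen 1) m)"
    unfolding m using y_absorb[of 1] by (simp add: e_gen_def)
  moreover have "y 2 \<otimes> normal_form m = normal_form (coords_mult (e_gen 2) m)"
  proof -
    have "y 2 \<otimes> normal_form m = bpow (y 1) b1 \<otimes> (bpow (y 2) (1 + b2) \<otimes> (bpow (z 2 1) b1 \<otimes>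
       (bpow (y 3) b3 \<otimes> (bpow (z 2 1) d21 \<otimes> (bpow (z 3 1) d31 \<otimes> bpow (z 3 2) d32)))))"
      unfolding m by (simp add: y_past_y[of 1 2] y_absorb[of 2] bpow_z_central[of 2 1 "bpow (y 2) _"]
          del: One_nat_def)
    also have "\<dots> = normal_form (coords_mult (e_gen 2) m)"
      unfolding m by (simp add: bpow_z_central[of 2 1 "bpow (y 3) _"] z_absorb e_gen_def add_ac
          del: One_nat_def)
    finally show ?thesis .
  qed
  moreover have "y 3 \<otimes> normal_form m = normal_form (coords_mult (e_gen 3) m)"
  proof -
    have "y 3 \<otimes> normal_form m = bpow (y 1) b1 \<otimes> (bpow (y 2) b2 \<otimes> (bpow (y 3) (1 + b3) \<otimes>
       (bpow (z 3 1) b1 \<otimes> (bpow (z 2 1) d21 \<otimes> (bpow (z 3 1) d31 \<otimes> (bpow (z 3 2) b2 \<otimes> bpow (z 3 2) d32))))))"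
      unfolding m by (simp add: y_past_y[of 1 3] y_past_y[of 2 3] y_absorb[of 3] bpow_z_central[of 3 1 "bpow (y _) _"]
         bpow_z_central[of 3 2 "bpow (y _) _"] bpow_z_central[of 3 2 "bpow (z _ 1) _"]
          del: One_nat_def)
    also have "\<dots> = normal_form (coords_mult (e_gen 3) m)"
      unfolding m by (simp add: bpow_z_central[of 3 1 "bpow (z 2 1) _"] z_absorb e_gen_def add_ac
          del: One_nat_def)
    finally show ?thesis .
  qed
  ultimately show ?thesis using assms by auto
qed

text \<open>
  A word has the same value in \<open>G\<close> as the normal form of its value in coordinates. So any relation
  between the generators of the coordinate group also holds between the \<open>y i\<close>.
\<close>

lemma normal_form_word_value:
  assumes "set w \<subseteq> {1, 2, 3} \<times> UNIV"
  shows "normal_form (word_value coords_group (map (apfst e_gen) w)) = word_value G (map (apfst y) w)"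
  using assms
proof (induction w)
  case Nil
  show ?case by (simp add: bpow_def)
next
  case (Cons a w)
  then obtain i b where "a = (i, b)" "i \<in> {1, 2, 3}" by auto
  with Cons show ?case by (simp add: y_mult_normal_form[symmetric] inv_y del: normal_form.simps)
qed

text \<open>
  The map \<open>normal_form\<close> is a left inverse of \<open>h\<close> because the \<open>y i\<close> generate, and a right inverse
  because the images of the \<open>y i\<close> and of their commutators can be computed.
\<close>

theorem iso_coords_group:
  assumes h: "h \<in> hom G coords_group" and hy: "\<And>i. i \<in> {1, 2, 3} \<Longrightarrow> h (y i) = e_gen i"
    and gen: "\<And>g. g \<in> carrier G \<Longrightarrow>
      \<exists>w. set w \<subseteq> {1, 2, 3} \<times> UNIV \<and> word_value G (map (apfst y) w) = g"
  shows "h \<in> iso G coords_group"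
proof (rule isoI[OF h])
  interpret h: group_hom G coords_group h
    using h by (simp add: group_hom_def group_hom_axioms_def group_coords_group)
  have left: "normal_form (h g) = g" if g: "g \<in> carrier G" for g
  proof -
    obtain w where w: "set w \<subseteq> {1, 2, 3} \<times> UNIV" "word_value G (map (apfst y) w) = g"
      using gen[OF g] by blast
    have "h g = word_value coords_group (map (apfst h) (map (apfst y) w))"
      using h.hom_word_value[OF map_apfst_letters[OF w(1), of y]] y_carrier w(2) by blast
    also have "map (apfst h) (map (apfst y) w) = map (apfst e_gen) w"
    proof -
      have "apfst h (apfst y p) = apfst e_gen p" if "p \<in> set w" for p
        using that w(1) hy[of "fst p"] by (cases p) auto
      then show ?thesis by simp
    qed
    finally show ?thesis using normal_form_word_value[OF w(1)] w(2) by simp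
  qed
  have hb: "h (bpow x b) = (if b = 1 then h x else (0, 0, 0, 0, 0, 0))" for x b
    by (simp add: bpow_def)
  have right: "h (normal_form m) = m" for m
    by (cases m) (simp add: hb h.hom_commutator hy commutator_def e_gen_def coords_inv)
  show "bij_betw h (carrier G) (carrier coords_group)"
    by (rule bij_betw_byWitness[where f' = normal_form])
      (use left right normal_form_closed in auto)
qed

end

section \<open>Palindromes\<close>

lemma freely_reduced_map:
  assumes "inj_on f S" and "set w \<subseteq> S \<times> UNIV" and "freely_reduced w"
  shows "freely_reduced (map (apfst f) w)"
  using assms(2,3)
proof (induction w)
  case (Cons a w)
  show ?case
  proof (cases w)
    case w: (Cons b v)
    have "apfst f b \<noteq> inv_letter (apfst f a)"
      using Cons.prems w assms(1) by (cases a; cases b) (auto simp: freely_reduced_Cons inj_on_def)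
    then show ?thesis using Cons w by (simp add: freely_reduced_Cons)
  qed (simp add: freely_reduced_Cons)
qed simp

text \<open>
  Injectivity on the generators is what keeps the image of a reduced word reduced: two letters
  could otherwise become mutually inverse.
\<close>

lemma (in group_hom) hom_is_palindrome:
  assumes "inj_on h S" and "S \<subseteq> carrier G" and "is_palindrome G S g"
  shows "is_palindrome H (h ` S) (h g)"
proof -
  obtain w where w: "set w \<subseteq> S \<times> UNIV" "freely_reduced w" "rev w = w" "word_value G w = g"
    using assms(3) by (auto simp: is_palindrome_def)
  have "set w \<subseteq> carrier G \<times> UNIV" using w(1) assms(2) by auto
  then have "word_value H (map (apfst h) w) = h g" using w(4) by (simp flip: hom_word_value)
  moreover have "rev (map (apfst h) w) = map (apfst h) w" using w(3) by (simp add: rev_map)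
  ultimately show ?thesis
    using map_apfst_letters[OF w(1) order_refl] freely_reduced_map[OF assms(1) w(1,2)]
    unfolding is_palindrome_def by blast
qed

lemma (in group) is_palindrome_closed:
  "\<lbrakk>S \<subseteq> carrier G; is_palindrome G S g\<rbrakk> \<Longrightarrow> g \<in> carrier G"
  unfolding is_palindrome_def by (blast intro: word_value_closed)

lemma (in group) list_product_closed:
  "set ps \<subseteq> carrier G \<Longrightarrow> foldr (\<otimes>) ps \<one> \<in> carrier G"
  by (induction ps) auto

lemma (in group_hom) hom_product_of_palindromes:
  assumes "inj_on h S" and "S \<subseteq> carrier G" and "product_of_palindromes G S k g"
  shows "product_of_palindromes H (h ` S) k (h g)"
proof -
  obtain ps where ps: "length ps = k" "\<forall>p\<in>set ps. is_palindrome G S p" "foldr (\<otimes>) ps \<one> = g"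
    using assms(3) by (auto simp: product_of_palindromes_def)
  have "set ps \<subseteq> carrier G" using ps(2) G.is_palindrome_closed[OF assms(2)] by blast
  then have "h (foldr (\<otimes>) ps \<one>) = foldr (\<otimes>\<^bsub>H\<^esub>) (map h ps) \<one>\<^bsub>H\<^esub>"
    by (induction ps) (simp_all add: G.list_product_closed)
  then show ?thesis unfolding product_of_palindromes_def
    using ps hom_is_palindrome[OF assms(1,2)] by (intro exI[of _ "map h ps"]) auto
qed

lemma product_of_palindromes_iso:
  assumes "group G" "group H" and h: "h \<in> iso G H" and S: "S \<subseteq> carrier G" and g: "g \<in> carrier G"
  shows "product_of_palindromes H (h ` S) k (h g) \<longleftrightarrow> product_of_palindromes G S k g"
proof
  have h': "h \<in> hom G H" and inj: "inj_on h (carrier G)"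
    using h by (auto simp: iso_def bij_betw_def)
  let ?h' = "inv_into (carrier G) h"
  have inv: "?h' \<in> iso H G" using group.iso_set_sym[OF assms(1) h] .
  interpret h: group_hom G H h
    using assms(1,2) h' by (simp add: group_hom_def group_hom_axioms_def)
  interpret h': group_hom H G ?h'
    using assms(1,2) inv by (simp add: group_hom_def group_hom_axioms_def iso_def)
  have id: "?h' ` h ` S = S" using inj S by simp
  have "h ` S \<subseteq> carrier H" using S by auto
  moreover have "inj_on ?h' (h ` S)" by (rule inj_on_inv_into) (use S in auto)
  ultimately show "product_of_palindromes G S k g" if "product_of_palindromes H (h ` S) k (h g)"
    using h'.hom_product_of_palindromes[OF _ _ that] id inj g by simp
  show "product_of_palindromes H (h ` S) k (h g)" if "product_of_palindromes G S k g"
    using h.hom_product_of_palindromes[OF inj_on_subset[OF inj S] S that] .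
qed

lemma is_palindrome_one: "is_palindrome G S \<one>\<^bsub>G\<^esub>"
  unfolding is_palindrome_def by (intro exI[of _ "[]"]) simp

text \<open>The empty word is a palindrome, so products can be padded with factors \<open>\<one>\<close>.\<close>

lemma (in group) product_of_palindromes_mono:
  assumes "S \<subseteq> carrier G" and "product_of_palindromes G S k g" and "k \<le> m"
  shows "product_of_palindromes G S m g"
proof -
  obtain ps where ps: "length ps = k" "\<forall>p\<in>set ps. is_palindrome G S p" "foldr (\<otimes>) ps \<one> = g"
    using assms(2) by (auto simp: product_of_palindromes_def)
  have g: "g \<in> carrier G"
    using ps list_product_closed is_palindrome_closed[OF assms(1)] by (metis subsetI)
  have "foldr (\<otimes>) (replicate n \<one> @ ps) \<one> = g" for n
    using ps(3) g by (induction n) auto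
  then show ?thesis unfolding product_of_palindromes_def
    using ps assms(3) by (intro exI[of _ "replicate (m - k) \<one> @ ps"]) (auto simp: is_palindrome_one)
qed

text \<open>A word without inverse letters is freely reduced, even if letters are repeated.\<close>

lemma is_palindrome_positive:
  assumes "set xs \<subseteq> S" and "rev xs = xs" and "foldr (\<otimes>\<^bsub>G\<^esub>) xs \<one>\<^bsub>G\<^esub> = g"
  shows "is_palindrome G S g"
proof -
  let ?w = "map (\<lambda>s. (s, True)) xs"
  have "freely_reduced ?w" by (induction xs) (auto simp: freely_reduced_Cons hd_map)
  moreover have "word_value G ?w = g"
    unfolding assms(3)[symmetric] by (induction xs) auto
  ultimately show ?thesis unfolding is_palindrome_def
    using assms(1,2) by (intro exI[of _ ?w]) (auto simp: rev_map)
qed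

section \<open>Palindromes in the coordinate group\<close>

definition E_gens :: "coords set" where
  "E_gens = e_gen ` {1, 2, 3}"

text \<open>
  The identity and the conjugates of the generators: conjugating \<open>e\<^sub>i\<close> can change only the two
  commutator coordinates that involve the index \<open>i\<close>, so the third one stays 0.
\<close>

fun palindromic :: "coords \<Rightarrow> bool" where
  "palindromic (a1, a2, a3, c21, c31, c32) \<longleftrightarrow>
     (a1, a2, a3, c21, c31, c32) = (0, 0, 0, 0, 0, 0) \<or>
     (a1, a2, a3, c32) = (1, 0, 0, 0) \<or> (a1, a2, a3, c31) = (0, 1, 0, 0) \<or>
     (a1, a2, a3, c21) = (0, 0, 1, 0)"

lemma coords_mult_zero: "coords_mult m (0, 0, 0, 0, 0, 0) = m"
  by (cases m) simp

lemma palindromic_conj: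
  assumes "i \<in> {1, 2, 3}" and "palindromic m"
  shows "palindromic (coords_mult (e_gen i) (coords_mult m (e_gen i)))"
  using assms by (cases m) (auto simp: e_gen_def)

text \<open>
  Peeling off the equal outer letters of a palindrome exhibits its value as a conjugate of the
  value of a shorter palindrome, since the generators are their own inverses.
\<close>

lemma word_value_palindromic:
  assumes "set w \<subseteq> E_gens \<times> UNIV" and "rev w = w"
  shows "palindromic (word_value coords_group w)"
  using assms
proof (induction w rule: length_induct)
  case less: (1 w)
  show ?case
  proof (cases w)
    case Nil
    then show ?thesis by simp
  next
    case a: (Cons a v)
    obtain i b where i: "i \<in> {1, 2, 3}" "a = (e_gen i, b)"
      using less.prems(1) a by (cases a) (auto simp: E_gens_def simp del: One_nat_def)
    show ?thesis
    proof (cases v rule: rev_cases)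
      case Nil
      then show ?thesis using a i by (auto simp: e_gen_def coords_inv)
    next
      case (snoc u c)
      have "c # rev u @ [a] = a # u @ [c]" using less.prems(2) unfolding a snoc
        by (simp only: rev.simps rev_append append.simps append_assoc)
      then have u: "c = a" "rev u = u"
        by (metis list.inject append1_eq_conv)+
      have "set (a # u @ [c]) \<subseteq> E_gens \<times> UNIV" using less.prems(1) unfolding a snoc .
      then have su: "set u \<subseteq> E_gens \<times> UNIV" by simp
      have "palindromic (word_value coords_group u)"
        using less.IH su u(2) by (simp add: a snoc)
      moreover have "word_value coords_group w =
          coords_mult (e_gen i) (coords_mult (word_value coords_group u) (e_gen i))"
      proof -
        have "(if b then e_gen i else inv\<^bsub>coords_group\<^esub> (e_gen i)) = e_gen i"
          using i(1) by simp
        then show ?thesis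
          using coords.word_value_append[of u "[a]"] unfolding a snoc u(1) i(2)
          by (simp only: word_value_Cons word_value_Nil coords_group_simps coords_mult_zero
              append_Cons UNIV_Times_UNIV subset_UNIV simp_thms)
      qed
      ultimately show ?thesis using palindromic_conj[OF i(1)] by simp
    qed
  qed
qed

text \<open>
  For the converse, conjugating \<open>e\<^sub>i\<close> by \<open>e\<^sub>j\<close> flips exactly the commutator coordinate of the
  indices \<open>i\<close> and \<open>j\<close>. So the word \<open>j k i k j\<close>, with \<open>j\<close> and \<open>k\<close> included as needed, reaches all
  four conjugates of \<open>e\<^sub>i\<close>.
\<close>

lemma is_palindrome_iff: "is_palindrome coords_group E_gens m \<longleftrightarrow> palindromic m"
proof
  assume "is_palindrome coords_group E_gens m"
  then show "palindromic m" by (auto simp: is_palindrome_def word_value_palindromic)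
next
  obtain a1 a2 a3 c21 c31 c32 where m: "m = (a1, a2, a3, c21, c31, c32)" by (cases m) auto
  define opt where "opt i b = (if b = (1::bit) then [e_gen i] else [])" for i b
  define conj_word where "conj_word j b k c i = opt j b @ opt k c @ [e_gen i] @ opt k c @ opt j b"
    for i j k b c
  have pal: "is_palindrome coords_group E_gens m"
    if "foldr coords_mult (conj_word j b k c i) (0, 0, 0, 0, 0, 0) = m"
      "i \<in> {1, 2, 3}" "j \<in> {1, 2, 3}" "k \<in> {1, 2, 3}" for i j k b c
    by (rule is_palindrome_positive[of "conj_word j b k c i"])
      (use that in \<open>auto simp: conj_word_def opt_def coords_group_def E_gens_def\<close>)
  assume "palindromic m"
  then consider "m = (0, 0, 0, 0, 0, 0)" | "m = (1, 0, 0, c21, c31, 0)"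
    | "m = (0, 1, 0, c21, 0, c32)" | "m = (0, 0, 1, 0, c31, c32)"
    using m by auto
  then show "is_palindrome coords_group E_gens m"
  proof cases
    case 1
    then show ?thesis using is_palindrome_one[of coords_group] by simp
  next
    case 2
    then show ?thesis using pal[of 2 c21 3 c31 1]
      by (cases c21; cases c31) (simp_all add: conj_word_def opt_def e_gen_def)
  next
    case 3
    then show ?thesis using pal[of 1 c21 3 c32 2]
      by (cases c21; cases c32) (simp_all add: conj_word_def opt_def e_gen_def)
  next
    case 4
    then show ?thesis using pal[of 1 c31 2 c32 3]
      by (cases c31; cases c32) (simp_all add: conj_word_def opt_def e_gen_def)
  qed
qed

lemma product_of_three_palindromes_iff:
  "product_of_palindromes coords_group E_gens 3 m \<longleftrightarrow>
     (\<exists>p q r. palindromic p \<and> palindromic q \<and> palindromic r \<and>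
        coords_mult p (coords_mult q r) = m)"
proof -
  have "product_of_palindromes coords_group E_gens 3 m \<longleftrightarrow>
      (\<exists>ps. length ps = 3 \<and> (\<forall>p\<in>set ps. palindromic p) \<and>
        foldr coords_mult ps (0, 0, 0, 0, 0, 0) = m)"
    unfolding product_of_palindromes_def is_palindrome_iff by (simp add: coords_group_def)
  also have "\<dots> \<longleftrightarrow> (\<exists>p q r. palindromic p \<and> palindromic q \<and> palindromic r \<and>
        coords_mult p (coords_mult q r) = m)"
  proof safe
    fix ps :: "coords list"
    assume "length ps = 3" and ps: "\<forall>p\<in>set ps. palindromic p"
    then obtain p q r where "ps = [p, q, r]"
      by (auto simp: numeral_3_eq_3 length_Suc_conv)
    with ps show "\<exists>p q r'. palindromic p \<and> palindromic q \<and> palindromic r' \<and>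
        coords_mult p (coords_mult q r') = foldr coords_mult ps (0, 0, 0, 0, 0, 0)"
      by (intro exI[of _ p] exI[of _ q] exI[of _ r]) (simp add: coords_mult_zero)
  next
    fix p q r assume "palindromic p" "palindromic q" "palindromic r"
    then show "\<exists>ps. length ps = 3 \<and> (\<forall>p\<in>set ps. palindromic p) \<and>
        foldr coords_mult ps (0, 0, 0, 0, 0, 0) = coords_mult p (coords_mult q r)"
      by (intro exI[of _ "[p, q, r]"]) (simp add: coords_mult_zero del: coords_mult.simps)
  qed
  finally show ?thesis .
qed

text \<open>
  An element with \<open>a = 0\<close> and a vanishing commutator coordinate is \<open>e\<^sub>i\<close> times a conjugate
  of \<open>e\<^sub>i\<close>, where \<open>i\<close> is the index missing from that coordinate. For \<open>a \<noteq> 0\<close> a conjugate of one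
  generator takes two commutator coordinates and a conjugate of another one the third.
\<close>

lemma not_product_of_three_palindromes_iff:
  "\<not> product_of_palindromes coords_group E_gens 3 m \<longleftrightarrow> m = (0, 0, 0, 1, 1, 1)"
proof
  assume n: "\<not> product_of_palindromes coords_group E_gens 3 m"
  show "m = (0, 0, 0, 1, 1, 1)"
  proof (rule ccontr)
    assume neq: "m \<noteq> (0, 0, 0, 1, 1, 1)"
    obtain a1 a2 a3 c21 c31 c32 where m: "m = (a1, a2, a3, c21, c31, c32)" by (cases m) auto
    have no: "\<lbrakk>palindromic p; palindromic q; palindromic r\<rbrakk> \<Longrightarrow>
        coords_mult p (coords_mult q r) \<noteq> m" for p q r
      using n product_of_three_palindromes_iff by blast
    let ?e = "(0, 0, 0, 0, 0, 0)"
    have "(a1, a2, a3) = (0, 0, 0) \<longrightarrow> c32 = 1"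
      using no[of "(1, 0, 0, 0, 0, 0)" "(1, 0, 0, c21, c31, 0)" ?e] m by auto
    moreover have "(a1, a2, a3) = (0, 0, 0) \<longrightarrow> c31 = 1"
      using no[of "(0, 1, 0, 0, 0, 0)" "(0, 1, 0, c21, 0, c32)" ?e] m by auto
    moreover have "(a1, a2, a3) = (0, 0, 0) \<longrightarrow> c21 = 1"
      using no[of "(0, 0, 1, 0, 0, 0)" "(0, 0, 1, 0, c31, c32)" ?e] m by auto
    moreover have "(a1, a2, a3) \<noteq> (1, 0, 0)"
      using no[of "(1, 0, 0, c21, c31, 0)" "(0, 1, 0, 0, 0, 0)" "(0, 1, 0, 0, 0, c32)"] m by auto
    moreover have "(a1, a2, a3) \<noteq> (0, 1, 0)"
      using no[of "(0, 1, 0, c21, 0, c32)" "(1, 0, 0, 0, 0, 0)" "(1, 0, 0, 0, c31, 0)"] m by auto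
    moreover have "(a1, a2, a3) \<noteq> (0, 0, 1)"
      using no[of "(0, 0, 1, 0, c31, c32)" "(1, 0, 0, 0, 0, 0)" "(1, 0, 0, c21, 0, 0)"] m by auto
    moreover have "(a1, a2, a3) \<noteq> (1, 1, 0)"
      using no[of "(1, 0, 0, c21, c31, 0)" "(0, 1, 0, 0, 0, c32)" ?e] m by auto
    moreover have "(a1, a2, a3) \<noteq> (1, 0, 1)"
      using no[of "(1, 0, 0, c21, c31, 0)" "(0, 0, 1, 0, 0, c32)" ?e] m by auto
    moreover have "(a1, a2, a3) \<noteq> (0, 1, 1)"
      using no[of "(0, 1, 0, c21, 0, c32)" "(0, 0, 1, 0, c31, 0)" ?e] m by auto
    moreover have "(a1, a2, a3) \<noteq> (1, 1, 1)"
      using no[of "(1, 0, 0, c21, c31, 0)" "(0, 1, 0, 0, 0, c32)" "(0, 0, 1, 0, 0, 0)"] m by auto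
    ultimately show False
      using neq m by (cases a1; cases a2; cases a3) simp_all
  qed
next
  have "coords_mult p (coords_mult q r) \<noteq> (0, 0, 0, 1, 1, 1)"
    if "palindromic p" "palindromic q" "palindromic r" for p q r
    using that by (cases p; cases q; cases r) auto
  then show "\<not> product_of_palindromes coords_group E_gens 3 m" if "m = (0, 0, 0, 1, 1, 1)"
    using that product_of_three_palindromes_iff by blast
qed

text \<open>
  Multiplying by the palindrome \<open>e\<^sub>1\<close> leads out of the commutator subgroup, where three factors
  suffice.
\<close>

lemma product_of_four_palindromes:
  "product_of_palindromes coords_group E_gens 4 (0, 0, 0, 1, 1, 1)"
proof -
  have "product_of_palindromes coords_group E_gens 3 (1, 0, 0, 1, 1, 1)"
    using not_product_of_three_palindromes_iff by fastforce
  then obtain ps where "length ps = 3" "\<forall>p\<in>set ps. is_palindrome coords_group E_gens p"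
      "foldr (\<otimes>\<^bsub>coords_group\<^esub>) ps \<one>\<^bsub>coords_group\<^esub> = (1, 0, 0, 1, 1, 1)"
    by (auto simp: product_of_palindromes_def)
  moreover have "is_palindrome coords_group E_gens (1, 0, 0, 0, 0, 0)"
    by (simp add: is_palindrome_iff)
  ultimately show ?thesis unfolding product_of_palindromes_def
    by (intro exI[of _ "(1, 0, 0, 0, 0, 0) # ps"]) simp
qed

lemma palindromic_length_coords:
  "palindromic_length coords_group E_gens (0, 0, 0, 1, 1, 1) = 4"
proof -
  have "4 \<le> enat k" if "product_of_palindromes coords_group E_gens k (0, 0, 0, 1, 1, 1)" for k
  proof -
    have "\<not> k \<le> 3"
      using coords.product_of_palindromes_mono[OF _ that, of 3]
        not_product_of_three_palindromes_iff[of "(0, 0, 0, 1, 1, 1)"] by auto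
    then show ?thesis by (simp add: numeral_eq_enat)
  qed
  moreover have "(4::enat) = enat 4" by (simp add: numeral_eq_enat)
  then have "Inf {enat k |k. product_of_palindromes coords_group E_gens k (0, 0, 0, 1, 1, 1)} \<le> 4"
    using product_of_four_palindromes by (intro Inf_lower) blast
  ultimately show ?thesis unfolding palindromic_length_def
    by (intro antisym Inf_greatest) blast+
qed

section \<open>The quotient of the free class two group\<close>

lemma gamma3_F3_eq: "gamma3_F3 = gamma3 F3"
  by (simp add: gamma3_F3_def gamma3_def)

interpretation F3: group F3
  unfolding F3_def by (rule group_free_group)

interpretation gamma3_F3: normal gamma3_F3 F3
  unfolding gamma3_F3_eq by (rule F3.normal_gamma3)

interpretation N32: group N32
  unfolding N32_def by (rule gamma3_F3.factorgroup_is_group)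

lemma x_gen_closed: "i \<in> {1, 2, 3} \<Longrightarrow> x_gen i \<in> carrier N32"
  unfolding x_gen_def N32_def F3_def carrier_FactGroup by (intro imageI free_group_letter_closed)

interpretation squares_closure: normal squares_closure N32
  unfolding squares_closure_def
  by (rule N32.normal_normal_closure) (use x_gen_closed in auto)

interpretation N32_tilde: group N32_tilde
  unfolding N32_tilde_def by (rule squares_closure.factorgroup_is_group)

definition F3_proj :: "nat word \<Rightarrow> nat word set set" where
  "F3_proj w = squares_closure #>\<^bsub>N32\<^esub> (gamma3_F3 #>\<^bsub>F3\<^esub> w)"

interpretation F3_proj: group_hom F3 N32_tilde F3_proj
proof -
  have "F3_proj = (\<lambda>x. squares_closure #>\<^bsub>N32\<^esub> x) \<circ> (\<lambda>w. gamma3_F3 #>\<^bsub>F3\<^esub> w)"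
    by (auto simp: F3_proj_def)
  then have "F3_proj \<in> hom F3 N32_tilde"
    using hom_compose[OF gamma3_F3.r_coset_hom_Mod squares_closure.r_coset_hom_Mod[unfolded N32_def]]
    by (simp add: N32_tilde_def N32_def)
  then show "group_hom F3 N32_tilde F3_proj"
    by (simp add: group_hom_def group_hom_axioms_def F3.is_group N32_tilde.is_group)
qed

lemma F3_proj_surj: "F3_proj ` carrier F3 = carrier N32_tilde"
  by (auto simp: F3_proj_def N32_tilde_def N32_def carrier_FactGroup)

lemma F3_proj_letter: "F3_proj [(i, True)] = y_gen i"
  by (simp add: F3_proj_def y_gen_def x_gen_def)

lemma F3_proj_gamma3: "gamma3 F3 \<subseteq> kernel F3 N32_tilde F3_proj"
proof
  fix w assume w: "w \<in> gamma3 F3"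
  then have wc: "w \<in> carrier F3" using gamma3_F3.subset gamma3_F3_eq by auto
  have "gamma3_F3 #>\<^bsub>F3\<^esub> w = \<one>\<^bsub>N32\<^esub>"
    using F3.coset_join2[OF wc gamma3_F3.subgroup_axioms] w by (simp add: gamma3_F3_eq N32_def)
  then have "F3_proj w = \<one>\<^bsub>N32_tilde\<^esub>"
    using N32.coset_join2[OF _ squares_closure.subgroup_axioms squares_closure.one_closed]
    by (simp add: F3_proj_def N32_tilde_def)
  with wc show "w \<in> kernel F3 N32_tilde F3_proj" by (simp add: kernel_def)
qed

lemma y_gen_closed: "i \<in> {1, 2, 3} \<Longrightarrow> y_gen i \<in> carrier N32_tilde"
  using F3_proj.hom_closed[of "[(i, True)]"] free_group_letter_closed[of i "{1, 2, 3}" True]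
  by (simp add: F3_proj_letter F3_def)

lemma y_gen_square:
  assumes "i \<in> {1, 2, 3}"
  shows "y_gen i \<otimes>\<^bsub>N32_tilde\<^esub> y_gen i = \<one>\<^bsub>N32_tilde\<^esub>"
proof -
  have x: "x_gen i \<in> carrier N32" using x_gen_closed assms .
  have "x_gen i [^]\<^bsub>N32\<^esub> (2::nat) \<in> squares_closure"
    unfolding squares_closure_def using assms by (intro subsetD[OF subset_normal_closure]) blast
  then have "x_gen i \<otimes>\<^bsub>N32\<^esub> x_gen i \<in> squares_closure"
    using x by (simp add: numeral_2_eq_2)
  then have "squares_closure #>\<^bsub>N32\<^esub> (x_gen i \<otimes>\<^bsub>N32\<^esub> x_gen i) = squares_closure"
    using x by (intro N32.coset_join2 squares_closure.subgroup_axioms) auto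
  then show ?thesis
    using squares_closure.rcos_sum[OF x x] by (simp add: y_gen_def N32_tilde_def)
qed

interpretation N32_tilde: class_two_three_involutions N32_tilde y_gen
  using F3_proj.class_two_of_surj[OF F3_proj_surj F3_proj_gamma3] y_gen_closed y_gen_square
  by unfold_locales

lemma N32_tilde_generated:
  assumes "g \<in> carrier N32_tilde"
  shows "\<exists>w. set w \<subseteq> {1, 2, 3} \<times> UNIV \<and> word_value N32_tilde (map (apfst y_gen) w) = g"
proof -
  obtain w where w: "w \<in> carrier F3" "g = F3_proj w" using assms F3_proj_surj by blast
  then have l: "set w \<subseteq> {1, 2, 3} \<times> UNIV" by (simp add: F3_def free_group_def)
  have "(\<lambda>s. [(s, True)]) ` {1, 2, 3} \<subseteq> carrier F3"
    unfolding F3_def by (intro image_subsetI free_group_letter_closed)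
  from F3_proj.hom_word_value[OF map_apfst_letters[OF l this]]
  have "g = word_value N32_tilde (map (apfst F3_proj) (map (apfst (\<lambda>s. [(s, True)])) w))"
    using free_group_word_value[of w "{1, 2, 3}"] w by (simp add: F3_def)
  also have "map (apfst F3_proj) (map (apfst (\<lambda>s. [(s, True)])) w) = map (apfst y_gen) w"
    by (simp add: F3_proj_letter apfst_compose o_def)
  finally show ?thesis using l by blast
qed

lemma N32_tilde_to_coords:
  obtains h where "h \<in> hom N32_tilde coords_group" "\<And>i. i \<in> {1, 2, 3} \<Longrightarrow> h (y_gen i) = e_gen i"
proof -
  define \<phi> where "\<phi> w = word_value coords_group (map (apfst e_gen) w)" for w
  have "\<phi> \<in> hom F3 coords_group"
    unfolding \<phi>_def[abs_def] F3_def by (rule coords.free_group_lift) simp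
  then interpret \<phi>: group_hom F3 coords_group \<phi>
    by (simp add: group_hom_def group_hom_axioms_def F3.is_group coords.is_group)
  have "gamma3_F3 \<subseteq> kernel F3 coords_group \<phi>"
    unfolding gamma3_F3_eq by (rule \<phi>.gamma3_subset_kernel[OF coords_class_two])
  \<comment> \<open>The map descends to the two successive quotients: the coordinate group has class two and its
    generators are involutions.\<close>
  from \<phi>.FactGroup_universal_kernel[OF gamma3_F3.normal_axioms this]
  obtain f where f: "f \<in> hom N32 coords_group"
      "\<And>w. w \<in> carrier F3 \<Longrightarrow> f (gamma3_F3 #>\<^bsub>F3\<^esub> w) = \<phi> w"
    unfolding N32_def by blast
  interpret f: group_hom N32 coords_group f
    using f(1) by (simp add: group_hom_def group_hom_axioms_def N32.is_group coords.is_group)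
  have fx: "f (x_gen i) = e_gen i" if "i \<in> {1, 2, 3}" for i
  proof -
    have "f (x_gen i) = \<phi> [(i, True)]"
      unfolding x_gen_def using f(2) free_group_letter_closed[OF that] unfolding F3_def .
    also have "\<dots> = e_gen i" by (simp add: \<phi>_def e_gen_def)
    finally show ?thesis .
  qed
  have "x_gen i [^]\<^bsub>N32\<^esub> (2::nat) \<in> kernel N32 coords_group f" if "i \<in> {1, 2, 3}" for i
  proof -
    have x: "x_gen i \<in> carrier N32" using x_gen_closed that .
    have "f (x_gen i \<otimes>\<^bsub>N32\<^esub> x_gen i) = \<one>\<^bsub>coords_group\<^esub>"
      unfolding f.hom_mult[OF x x] fx[OF that] using that by (auto simp: e_gen_def)
    then show ?thesis using x by (simp add: kernel_def numeral_2_eq_2)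
  qed
  then have "squares_closure \<subseteq> kernel N32 coords_group f"
    unfolding squares_closure_def by (intro normal_closure_least f.normal_kernel) blast
  from f.FactGroup_universal_kernel[OF squares_closure.normal_axioms this]
  obtain h where h: "h \<in> hom N32_tilde coords_group"
      "\<And>x. x \<in> carrier N32 \<Longrightarrow> h (squares_closure #>\<^bsub>N32\<^esub> x) = f x"
    unfolding N32_tilde_def by blast
  show thesis
    by (rule that[OF h(1)]) (use h(2) fx x_gen_closed in \<open>simp add: y_gen_def\<close>)
qed

theorem proposition1p2:
  shows "{g \<in> carrier N32_tilde. \<not> product_of_palindromes N32_tilde Y_gens 3 g} =
           {z_comm 2 1 \<otimes>\<^bsub>N32_tilde\<^esub> z_comm 3 1 \<otimes>\<^bsub>N32_tilde\<^esub> z_comm 3 2}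
         \<and> palindromic_length N32_tilde Y_gens
             (z_comm 2 1 \<otimes>\<^bsub>N32_tilde\<^esub> z_comm 3 1 \<otimes>\<^bsub>N32_tilde\<^esub> z_comm 3 2) = 4"
proof -
  let ?z = "z_comm 2 1 \<otimes>\<^bsub>N32_tilde\<^esub> z_comm 3 1 \<otimes>\<^bsub>N32_tilde\<^esub> z_comm 3 2"
  obtain h where h: "h \<in> hom N32_tilde coords_group"
    and hy: "\<And>i. i \<in> {1, 2, 3} \<Longrightarrow> h (y_gen i) = e_gen i"
    using N32_tilde_to_coords by blast
  interpret h: group_hom N32_tilde coords_group h
    using h by (simp add: group_hom_def group_hom_axioms_def N32_tilde.is_group coords.is_group)
  have iso: "h \<in> iso N32_tilde coords_group"
    using N32_tilde.iso_coords_group[OF h hy N32_tilde_generated] .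
  then have inj: "inj_on h (carrier N32_tilde)" by (simp add: iso_def bij_betw_def)
  have Y: "Y_gens = y_gen ` {1, 2, 3}" "Y_gens \<subseteq> carrier N32_tilde"
    using y_gen_closed by (auto simp: Y_gens_def)
  have hY: "h ` Y_gens = E_gens" using hy unfolding Y(1) E_gens_def image_image by (intro image_cong refl)
  have pal: "product_of_palindromes N32_tilde Y_gens k g \<longleftrightarrow>
      product_of_palindromes coords_group E_gens k (h g)" if "g \<in> carrier N32_tilde" for k g
    using product_of_palindromes_iso[OF N32_tilde.is_group coords.is_group iso Y(2) that]
    unfolding hY by blast
  have zc: "?z \<in> carrier N32_tilde"
    unfolding z_comm_def using N32_tilde.z_closed by simp
  have hz: "h ?z = (0, 0, 0, 1, 1, 1)"
    unfolding z_comm_def by (simp add: h.hom_commutator hy e_gen_def coords_commutator)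
  have "{g \<in> carrier N32_tilde. \<not> product_of_palindromes N32_tilde Y_gens 3 g} =
      {g \<in> carrier N32_tilde. h g = h ?z}"
    using pal by (intro Collect_cong conj_cong refl) (simp only: not_product_of_three_palindromes_iff hz)
  also have "\<dots> = {?z}" using inj zc by (auto dest: inj_onD)
  finally have "{g \<in> carrier N32_tilde. \<not> product_of_palindromes N32_tilde Y_gens 3 g} = {?z}" .
  moreover have "palindromic_length N32_tilde Y_gens ?z = 4"
    using palindromic_length_coords unfolding palindromic_length_def pal[OF zc] hz .
  ultimately show ?thesis by blast
qed

end
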